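(* Let $m(n)$ denote the number of maximal independent sets of the meta-pentagonal cactus $M(n)$. Then $m(1)=5$, $m(2)=13$, and $m(n)=3m(n-1)-m(n-2)$ for all $n\ge 3$.
   Context: For $n\ge 1$, the meta-pentagonal cactus $M(n)$ is the graph formed by a chain of $n$ 5-cycles $B_1,\dots,B_n$, where for each $1\le i\le n-1$ the consecutive cycles $B_i$ and $B_{i+1}$ share exactly one vertex, non-consecutive cycles share no vertex, every vertex lies in at most two cycles, and for each $2\le i\le n-1$ the two shared (cut) vertices of $B_i$ are at distance two in $B_i$. An independent set is maximal if no further vertex can be added while keeping it independent. *)

theory Defs
  imports "Graph_Theory.Pair_Digraph" "Graph_Theory.Shortest_Path"
begin

text \<open>Graphs are represented as in \<^verbatim>\<open>Graph_Theory\<close>: an undirected edge is a pair of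
  opposite arcs.\<close>

definition is_cycle_graph :: "nat \<Rightarrow> 'a pair_pre_digraph \<Rightarrow> bool" where
  "is_cycle_graph k C \<longleftrightarrow>
    (\<exists>vs. length vs = k \<and> distinct vs \<and> pverts C = set vs \<and>
      parcs C = (\<Union>i<k. {(vs ! i, vs ! (Suc i mod k)), (vs ! (Suc i mod k), vs ! i)}))"

definition graph_dist :: "'a pair_pre_digraph \<Rightarrow> 'a \<Rightarrow> 'a \<Rightarrow> ereal" where
  "graph_dist G u v = wf_digraph.\<mu> (with_proj G) (\<lambda>_. 1) u v"

definition meta_pentagonal_cactus :: "nat \<Rightarrow> 'a pair_pre_digraph \<Rightarrow> bool" where
  "meta_pentagonal_cactus n G \<longleftrightarrow>
    (\<exists>B :: nat \<Rightarrow> 'a pair_pre_digraph.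
      (\<forall>i\<in>{1..n}. is_cycle_graph 5 (B i)) \<and>
      pverts G = (\<Union>i\<in>{1..n}. pverts (B i)) \<and>
      parcs G = (\<Union>i\<in>{1..n}. parcs (B i)) \<and>
      (\<forall>i. 1 \<le> i \<and> i + 1 \<le> n \<longrightarrow> card (pverts (B i) \<inter> pverts (B (i + 1))) = 1) \<and>
      (\<forall>i\<in>{1..n}. \<forall>j\<in>{1..n}. i + 1 < j \<longrightarrow> pverts (B i) \<inter> pverts (B j) = {}) \<and>
      (\<forall>v\<in>pverts G. card {i\<in>{1..n}. v \<in> pverts (B i)} \<le> 2) \<and>
      (\<forall>i. 2 \<le> i \<and> i + 1 \<le> n \<longrightarrow>
        (\<forall>u \<in> pverts (B (i - 1)) \<inter> pverts (B i). \<forall>w \<in> pverts (B i) \<inter> pverts (B (i + 1)).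
          graph_dist (B i) u w = 2)))"

definition independent_set :: "'a pair_pre_digraph \<Rightarrow> 'a set \<Rightarrow> bool" where
  "independent_set G S \<longleftrightarrow> S \<subseteq> pverts G \<and> (\<forall>u\<in>S. \<forall>v\<in>S. (u, v) \<notin> parcs G)"

definition maximal_independent_set :: "'a pair_pre_digraph \<Rightarrow> 'a set \<Rightarrow> bool" where
  "maximal_independent_set G S \<longleftrightarrow>
    independent_set G S \<and> (\<forall>v \<in> pverts G - S. \<not> independent_set G (insert v S))"

definition num_maximal_independent_sets :: "'a pair_pre_digraph \<Rightarrow> nat" where
  "num_maximal_independent_sets G = card {S. maximal_independent_set G S}"

lemma is_cycle_graph_imp_pair_graph:
  assumes "is_cycle_graph k C" "k \<ge> 3"
  shows "pair_graph C"
proof -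
  obtain vs where vs: "length vs = k" "distinct vs" "pverts C = set vs"
      "parcs C = (\<Union>i<k. {(vs ! i, vs ! (Suc i mod k)), (vs ! (Suc i mod k), vs ! i)})"
    using assms(1) unfolding is_cycle_graph_def by blast
  have mem: "vs ! i \<in> set vs" "vs ! (Suc i mod k) \<in> set vs" if "i < k" for i
    using that vs(1) by auto
  have "Suc i mod k \<noteq> i" if "i < k" for i
    using that assms(2) by (cases "Suc i = k") auto
  then have ne: "vs ! (Suc i mod k) \<noteq> vs ! i" if "i < k" for i
    using that vs(1,2) assms(2) by (simp add: nth_eq_iff_index_eq)
  show ?thesis
  proof unfold_locales
    show "fst e \<in> pverts C" if "e \<in> parcs C" for e
      using that mem unfolding vs(3,4) by auto
    show "snd e \<in> pverts C" if "e \<in> parcs C" for e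
      using that mem unfolding vs(3,4) by auto
    show "finite (pverts C)" "finite (parcs C)"
      unfolding vs(3,4) by auto
    show "fst e \<noteq> snd e" if "e \<in> parcs C" for e
      using that ne unfolding vs(4) by fastforce
    show "symmetric (with_proj C)"
      unfolding symmetric_def with_proj_simps sym_def vs(4) by blast
  qed
qed

lemma meta_pentagonal_cactus_imp_pair_graph:
  assumes "meta_pentagonal_cactus n G"
  shows "pair_graph G"
proof -
  obtain B :: "nat \<Rightarrow> 'a pair_pre_digraph" where
    B: "\<forall>i\<in>{1..n}. is_cycle_graph 5 (B i)"
       "pverts G = (\<Union>i\<in>{1..n}. pverts (B i))" "parcs G = (\<Union>i\<in>{1..n}. parcs (B i))"
    using assms unfolding meta_pentagonal_cactus_def by blast
  have pg: "pair_graph (B i)" if "i \<in> {1..n}" for i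
    using B(1) that by (intro is_cycle_graph_imp_pair_graph[of 5]) auto
  note loc = pair_graph_def pair_digraph_def pair_pseudo_graph_def pair_fin_digraph_def
    pair_fin_digraph_axioms_def pair_loopfree_digraph_def pair_loopfree_digraph_axioms_def
    pair_sym_digraph_def pair_sym_digraph_axioms_def pair_wf_digraph_def
  have *: "finite (pverts (B i))" "finite (parcs (B i))" "symmetric (with_proj (B i))"
      "\<And>e. e \<in> parcs (B i) \<Longrightarrow> fst e \<in> pverts (B i) \<and> snd e \<in> pverts (B i) \<and> fst e \<noteq> snd e"
    if "i \<in> {1..n}" for i
    using pg[OF that] unfolding loc by auto
  show ?thesis
  proof unfold_locales
    show "fst e \<in> pverts G" if "e \<in> parcs G" for e
      using that * unfolding B(2,3) by blast
    show "snd e \<in> pverts G" if "e \<in> parcs G" for e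
      using that * unfolding B(2,3) by blast
    show "finite (pverts G)" "finite (parcs G)"
      unfolding B(2,3) using * by auto
    show "fst e \<noteq> snd e" if "e \<in> parcs G" for e
      using that * unfolding B(2,3) by blast
    show "symmetric (with_proj G)"
      using *(3) unfolding symmetric_def with_proj_simps sym_def B(3) by blast
  qed
qed

lemma graph_dist_eq_2I:
  assumes "pair_graph G" "(u, x) \<in> parcs G" "(x, w) \<in> parcs G" "u \<noteq> w" "(u, w) \<notin> parcs G"
  shows "graph_dist G u w = 2"
proof -
  interpret pair_graph G by fact
  have mu: "graph_dist G u w = (INF p\<in>{p. awalk u p w}. ereal (awalk_cost (\<lambda>_. 1) p))"
    unfolding graph_dist_def \<mu>_def ..
  have cost: "awalk_cost (\<lambda>_. 1) p = real (length p)" for p :: "('a \<times> 'a) list"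
    by (induction p) auto
  have "awalk u [(u, x), (x, w)] w"
    using assms(2,3) in_arcsD1 in_arcsD2 by (auto simp: awalk_def)
  then have "graph_dist G u w \<le> ereal (awalk_cost (\<lambda>_. 1) [(u, x), (x, w)])"
    unfolding mu by (intro INF_lower) auto
  then have le: "graph_dist G u w \<le> 2"
    by (simp add: cost)
  have "2 \<le> length p" if "awalk u p w" for p
  proof (rule ccontr)
    assume "\<not> 2 \<le> length p"
    then have "p = [] \<or> (\<exists>e. p = [e])"
      by (cases p; cases "tl p") auto
    then show False
      using that assms(4,5) by (auto simp: awalk_def)
  qed
  then have "2 \<le> graph_dist G u w"
    unfolding mu by (intro INF_greatest) (simp add: cost)
  with le show ?thesis by (rule antisym)
qed

text \<open>Such graphs exist for every length. The cut vertices of the following chain are the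
  multiples of 4.\<close>

lemma meta_pentagonal_cactus_exists:
  "\<exists>G :: nat pair_pre_digraph. meta_pentagonal_cactus n G"
proof -
  define vs :: "nat \<Rightarrow> nat list" where
    "vs i = [4*i, 4*i + 1, 4*i + 4, 4*i + 2, 4*i + 3]" for i
  define B :: "nat \<Rightarrow> nat pair_pre_digraph" where
    "B i = \<lparr> pverts = set (vs (i - 1)),
      parcs = (\<Union>k<5. {(vs (i - 1) ! k, vs (i - 1) ! (Suc k mod 5)),
                       (vs (i - 1) ! (Suc k mod 5), vs (i - 1) ! k)}) \<rparr>" for i
  define G :: "nat pair_pre_digraph" where
    "G = \<lparr> pverts = (\<Union>i\<in>{1..n}. pverts (B i)), parcs = (\<Union>i\<in>{1..n}. parcs (B i)) \<rparr>"
  have cyc: "is_cycle_graph 5 (B i)" for i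
    unfolding is_cycle_graph_def B_def
    by (rule exI[of _ "vs (i - 1)"]) (auto simp: vs_def)
  have V: "pverts (B i) = {4 * (i - 1) .. 4 * (i - 1) + 4}" for i
    unfolding B_def vs_def by auto
  have lt5: "{..<5} = {0, 1, 2, 3, 4 :: nat}" by auto
  have A: "parcs (B i) = (let j = 4 * (i - 1) in
      {(j, j+1), (j+1, j), (j+1, j+4), (j+4, j+1), (j+4, j+2), (j+2, j+4),
       (j+2, j+3), (j+3, j+2), (j+3, j), (j, j+3)})" for i
    unfolding B_def Let_def lt5 by (simp add: vs_def) auto
  have inter: "pverts (B i) \<inter> pverts (B (i + 1)) = {4 * i}" if "1 \<le> i" for i
    using that unfolding V by auto
  have "meta_pentagonal_cactus n G"
    unfolding meta_pentagonal_cactus_def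
  proof (intro exI[of _ B] conjI ballI allI impI)
    show "is_cycle_graph 5 (B i)" for i by (rule cyc)
    show "pverts G = (\<Union>i\<in>{1..n}. pverts (B i))" "parcs G = (\<Union>i\<in>{1..n}. parcs (B i))"
      by (simp_all add: G_def)
    show "card (pverts (B i) \<inter> pverts (B (i + 1))) = 1" if "1 \<le> i \<and> i + 1 \<le> n" for i
      using inter[of i] that by simp
    show "pverts (B i) \<inter> pverts (B j) = {}" if "i \<in> {1..n}" "j \<in> {1..n}" "i + 1 < j" for i j
      using that unfolding V by auto
    show "card {i \<in> {1..n}. v \<in> pverts (B i)} \<le> 2" for v
    proof -
      have "{i \<in> {1..n}. v \<in> pverts (B i)} \<subseteq> {v div 4, v div 4 + 1}"
        unfolding V by auto
      then have "card {i \<in> {1..n}. v \<in> pverts (B i)} \<le> card {v div 4, v div 4 + 1}"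
        by (intro card_mono) auto
      then show ?thesis by simp
    qed
    show "graph_dist (B i) u w = 2"
      if i: "2 \<le> i \<and> i + 1 \<le> n" and u: "u \<in> pverts (B (i - 1)) \<inter> pverts (B i)"
        and w: "w \<in> pverts (B i) \<inter> pverts (B (i + 1))" for i u w
    proof -
      have u': "u = 4 * (i - 1)" using i u unfolding V by auto
      have w': "w = 4 * (i - 1) + 4" using i w unfolding V by auto
      show ?thesis
        by (rule graph_dist_eq_2I[where x = "4 * (i - 1) + 1"])
           (auto simp: u' w' A Let_def intro: is_cycle_graph_imp_pair_graph[OF cyc])
    qed
  qed
  then show ?thesis by blast
qed

end

theory Submission
  imports Defs "HOL-Number_Theory.Fib"
begin

text \<open>
  Call an independent set near-maximal with respect to a vertex \<open>x\<close> if it dominates every vertex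
  except possibly \<open>x\<close>. Suppose a pentagon \<open>u p w q r\<close> is glued to a graph at the vertex \<open>u\<close>. A
  near-maximal set with respect to \<open>u\<close> that contains \<open>u\<close> extends to the new graph by \<open>{w}\<close> or \<open>{q}\<close>,
  and one that avoids \<open>u\<close> extends by \<open>{w, r}\<close>, \<open>{p, r}\<close> or \<open>{p, q}\<close>. These are all the near-maximal
  sets with respect to \<open>w\<close>, and all of them happen to dominate \<open>w\<close>, so they are the maximal
  independent sets. Hence the pair (number of sets containing the end vertex, number of sets
  avoiding it) evolves by \<open>(a, b) \<mapsto> (a + b, a + 2b)\<close>. Starting from the single vertex, where the
  pair is \<open>(1, 1)\<close>, it is \<open>(fib (2n+1), fib (2n+2))\<close> after \<open>n\<close> pentagons.
\<close>

definition near_maximal :: "'a set \<Rightarrow> ('a \<times> 'a) set \<Rightarrow> 'a \<Rightarrow> 'a set \<Rightarrow> bool" where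
  "near_maximal V A x S \<longleftrightarrow> S \<subseteq> V \<and> (\<forall>s\<in>S. \<forall>t\<in>S. (s, t) \<notin> A) \<and>
    (\<forall>v\<in>V - S - {x}. \<exists>s\<in>S. (s, v) \<in> A)"

definition pentagon_arcs :: "'a \<Rightarrow> 'a \<Rightarrow> 'a \<Rightarrow> 'a \<Rightarrow> 'a \<Rightarrow> ('a \<times> 'a) set" where
  "pentagon_arcs u p w q r =
    {(u, p), (p, u), (p, w), (w, p), (w, q), (q, w), (q, r), (r, q), (r, u), (u, r)}"

lemma pentagon_cases:
  assumes "is_cycle_graph 5 C"
  obtains a b c d e where "distinct [a, b, c, d, e]" "pverts C = {a, b, c, d, e}"
    "parcs C = pentagon_arcs a b c d e"
proof -
  obtain vs where vs: "length vs = 5" "distinct vs" "pverts C = set vs"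
      "parcs C = (\<Union>i<5. {(vs ! i, vs ! (Suc i mod 5)), (vs ! (Suc i mod 5), vs ! i)})"
    using assms unfolding is_cycle_graph_def by blast
  obtain a b c d e where abcde: "vs = [a, b, c, d, e]"
    using vs(1) by (auto simp: numeral_eq_Suc length_Suc_conv)
  have lt5: "{..<5} = {0, 1, 2, 3, 4 :: nat}" by auto
  have "parcs C = pentagon_arcs a b c d e"
    unfolding vs(4) abcde lt5 pentagon_arcs_def by simp blast
  with vs(2,3) abcde show thesis by (intro that) auto
qed

lemma pentagon_rotate: "pentagon_arcs a b c d e = pentagon_arcs b c d e a"
  unfolding pentagon_arcs_def by auto

lemma pentagon_reflect: "pentagon_arcs a b c d e = pentagon_arcs a e d c b"
  unfolding pentagon_arcs_def by auto

lemma pentagon_from_vertex: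
  assumes "is_cycle_graph 5 C" "u \<in> pverts C"
  obtains b c d e where "distinct [u, b, c, d, e]" "pverts C = {u, b, c, d, e}"
    "parcs C = pentagon_arcs u b c d e"
proof -
  obtain a b c d e where C: "distinct [a, b, c, d, e]" "pverts C = {a, b, c, d, e}"
    "parcs C = pentagon_arcs a b c d e"
    using pentagon_cases[OF assms(1)] by metis
  have rot: "parcs C = pentagon_arcs b c d e a" "parcs C = pentagon_arcs c d e a b"
    "parcs C = pentagon_arcs d e a b c" "parcs C = pentagon_arcs e a b c d"
    using C(3) pentagon_rotate by metis+
  consider "u = a" | "u = b" | "u = c" | "u = d" | "u = e"
    using assms(2) C(2) by blast
  then show thesis
  proof cases
    case 1 show thesis by (rule that[of b c d e]) (use 1 C in auto)
  next
    case 2 show thesis by (rule that[of c d e a]) (use 2 C rot in auto)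
  next
    case 3 show thesis by (rule that[of d e a b]) (use 3 C rot in auto)
  next
    case 4 show thesis by (rule that[of e a b c]) (use 4 C rot in auto)
  next
    case 5 show thesis by (rule that[of a b c d]) (use 5 C rot in auto)
  qed
qed

lemma pentagon_from_nonadjacent:
  assumes "is_cycle_graph 5 C" "u \<in> pverts C" "w \<in> pverts C" "u \<noteq> w" "(u, w) \<notin> parcs C"
  obtains p q r where "distinct [u, p, w, q, r]" "pverts C = {u, p, w, q, r}"
    "parcs C = pentagon_arcs u p w q r"
proof -
  obtain b c d e where C: "distinct [u, b, c, d, e]" "pverts C = {u, b, c, d, e}"
    "parcs C = pentagon_arcs u b c d e"
    using pentagon_from_vertex[OF assms(1,2)] by metis
  have "w = c \<or> w = d"
    using assms(3-5) C(2,3) by (auto simp: pentagon_arcs_def)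
  then show thesis
  proof
    assume "w = c" show thesis by (rule that[of b d e]) (use \<open>w = c\<close> C in auto)
  next
    assume "w = d"
    have "parcs C = pentagon_arcs u e d c b" using C(3) pentagon_reflect by metis
    then show thesis by (intro that[of e c b]) (use \<open>w = d\<close> C in auto)
  qed
qed

lemma pentagon_nonadjacent_exists:
  assumes "is_cycle_graph 5 C" "u \<in> pverts C"
  obtains w where "w \<in> pverts C" "u \<noteq> w" "(u, w) \<notin> parcs C" "(w, u) \<notin> parcs C"
proof -
  obtain b c d e where C: "distinct [u, b, c, d, e]" "pverts C = {u, b, c, d, e}"
    "parcs C = pentagon_arcs u b c d e"
    using pentagon_from_vertex[OF assms] by metis
  show thesis by (rule that[of c]) (use C in \<open>auto simp: pentagon_arcs_def\<close>)
qed

lemma graph_dist_eq_2D: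
  assumes "pair_graph G" "u \<in> pverts G" "graph_dist G u w = 2"
  shows "u \<noteq> w" "(u, w) \<notin> parcs G"
proof -
  interpret pair_graph G by fact
  have le: "2 \<le> ereal (awalk_cost (\<lambda>_. 1) p)" if "awalk u p w" for p
    using assms(3) that unfolding graph_dist_def \<mu>_def by (metis INF_lower mem_Collect_eq)
  show "u \<noteq> w"
  proof
    assume "u = w"
    then have "awalk u [] w" using assms(2) by (auto simp: awalk_def)
    from le[OF this] show False by simp
  qed
  show "(u, w) \<notin> parcs G"
  proof
    assume "(u, w) \<in> parcs G"
    then have "awalk u [(u, w)] w" using assms(2) by (auto simp: awalk_def)
    from le[OF this] show False by simp
  qed
qed

lemma maximal_independent_set_iff:
  assumes "pair_graph G"
  shows "maximal_independent_set G S \<longleftrightarrow> S \<subseteq> pverts G \<and> (\<forall>s\<in>S. \<forall>t\<in>S. (s, t) \<notin> parcs G) \<and>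
    (\<forall>v\<in>pverts G - S. \<exists>s\<in>S. (s, v) \<in> parcs G)"
proof -
  interpret pair_graph G by fact
  have sym: "(s, t) \<in> parcs G \<Longrightarrow> (t, s) \<in> parcs G" for s t
    by (rule arcs_symmetric)
  have irrefl: "(s, s) \<notin> parcs G" for s
    using no_loops by fastforce
  show ?thesis
    unfolding maximal_independent_set_def independent_set_def
    using sym irrefl by blast
qed

locale pentagon_glued =
  fixes V :: "'a set" and A :: "('a \<times> 'a) set" and u p w q r :: 'a
  assumes u: "u \<in> V" and A: "A \<subseteq> V \<times> V" and fin: "finite V"
    and dist: "distinct [u, p, w, q, r]" and disj: "{p, w, q, r} \<inter> V = {}"
begin

abbreviation "V' \<equiv> V \<union> {u, p, w, q, r}"
abbreviation "A' \<equiv> A \<union> pentagon_arcs u p w q r"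

lemma outside: "p \<notin> V" "w \<notin> V" "q \<notin> V" "r \<notin> V"
  using disj by auto

lemma arcs_iff:
  "(s, p) \<in> A' \<longleftrightarrow> s = u \<or> s = w" "(s, w) \<in> A' \<longleftrightarrow> s = p \<or> s = q"
  "(s, q) \<in> A' \<longleftrightarrow> s = w \<or> s = r" "(s, r) \<in> A' \<longleftrightarrow> s = q \<or> s = u"
  "(p, s) \<in> A' \<longleftrightarrow> s = u \<or> s = w" "(w, s) \<in> A' \<longleftrightarrow> s = p \<or> s = q"
  "(q, s) \<in> A' \<longleftrightarrow> s = w \<or> s = r" "(r, s) \<in> A' \<longleftrightarrow> s = q \<or> s = u"
  using A outside dist unfolding pentagon_arcs_def by auto

lemma arcs_inside: "s \<in> V \<Longrightarrow> t \<in> V \<Longrightarrow> (s, t) \<in> A' \<longleftrightarrow> (s, t) \<in> A"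
  using A outside dist unfolding pentagon_arcs_def by auto

lemma arcs_into:
  "v \<in> V \<Longrightarrow> v \<noteq> u \<Longrightarrow> (s, v) \<in> A' \<longleftrightarrow> s \<in> V \<and> (s, v) \<in> A"
  using A outside dist unfolding pentagon_arcs_def by auto

lemma near_maximal_glued_iff:
  "near_maximal V' A' w T \<longleftrightarrow> T \<subseteq> V' \<and> near_maximal V A u (T \<inter> V) \<and>
    (u \<in> T \<and> (T - V = {w} \<or> T - V = {q}) \<or>
     u \<notin> T \<and> (T - V = {w, r} \<or> T - V = {p, r} \<or> T - V = {p, q}))"
  (is "?L \<longleftrightarrow> ?R")
proof
  assume ?L
  then have sub: "T \<subseteq> V'" and ind: "\<And>s t. s \<in> T \<Longrightarrow> t \<in> T \<Longrightarrow> (s, t) \<notin> A'"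
    and dom: "\<And>v. v \<in> V' \<Longrightarrow> v \<notin> T \<Longrightarrow> v \<noteq> w \<Longrightarrow> \<exists>s\<in>T. (s, v) \<in> A'"
    unfolding near_maximal_def by auto
  have "near_maximal V A u (T \<inter> V)"
    unfolding near_maximal_def
  proof (intro conjI ballI)
    fix v assume v: "v \<in> V - T \<inter> V - {u}"
    then have "v \<noteq> w" using outside by auto
    then obtain s where "s \<in> T" "(s, v) \<in> A'" using dom[of v] v by auto
    with v arcs_into[of v s] show "\<exists>s\<in>T \<inter> V. (s, v) \<in> A" by auto
  qed (use ind in auto)
  moreover have TV: "T - V \<subseteq> {p, w, q, r}" using sub u by auto
  moreover have
    "p \<in> T \<Longrightarrow> u \<notin> T \<and> w \<notin> T" "q \<in> T \<Longrightarrow> w \<notin> T \<and> r \<notin> T" "r \<in> T \<Longrightarrow> u \<notin> T"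
    "p \<in> T \<or> u \<in> T \<or> w \<in> T" "q \<in> T \<or> w \<in> T \<or> r \<in> T" "r \<in> T \<or> q \<in> T \<or> u \<in> T"
    using ind[of p] ind[of q] ind[of r] dom[of p] dom[of q] dom[of r] dist
    unfolding arcs_iff by auto
  moreover have "T - V = {x \<in> {p, w, q, r}. x \<in> T}"
    using TV outside by auto
  ultimately show ?R using sub by (cases "u \<in> T"; cases "w \<in> T"; cases "q \<in> T") auto
next
  assume R: ?R
  then have sub: "T \<subseteq> V'" and ind: "\<And>s t. s \<in> T \<Longrightarrow> t \<in> T \<Longrightarrow> s \<in> V \<Longrightarrow> t \<in> V \<Longrightarrow> (s, t) \<notin> A"
    and dom: "\<And>v. v \<in> V \<Longrightarrow> v \<notin> T \<Longrightarrow> v \<noteq> u \<Longrightarrow> \<exists>s\<in>T \<inter> V. (s, v) \<in> A"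
    unfolding near_maximal_def by auto
  define X where "X = T - V"
  have X: "u \<in> T \<and> (X = {w} \<or> X = {q}) \<or>
     u \<notin> T \<and> (X = {w, r} \<or> X = {p, r} \<or> X = {p, q})"
    using R unfolding X_def by blast
  have mem: "p \<in> T \<longleftrightarrow> p \<in> X" "w \<in> T \<longleftrightarrow> w \<in> X" "q \<in> T \<longleftrightarrow> q \<in> X" "r \<in> T \<longleftrightarrow> r \<in> X"
    using outside unfolding X_def by auto
  have "(s, t) \<notin> A'" if "s \<in> T" "t \<in> T" for s t
  proof (cases "s \<in> V \<and> t \<in> V")
    case True
    then show ?thesis using ind that arcs_inside by metis
  next
    case False
    then have "s \<in> X \<or> t \<in> X" using that unfolding X_def by auto
    then have "s \<in> {p, w, q, r} \<or> t \<in> {p, w, q, r}" using X by auto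
    moreover have "p \<in> T \<Longrightarrow> u \<notin> T \<and> w \<notin> T" "q \<in> T \<Longrightarrow> w \<notin> T \<and> r \<notin> T" "r \<in> T \<Longrightarrow> u \<notin> T"
      using X mem dist by auto
    ultimately show ?thesis using that arcs_iff by (elim insertE emptyE disjE) metis+
  qed
  moreover have "\<exists>s\<in>T. (s, v) \<in> A'" if "v \<in> V'" "v \<notin> T" "v \<noteq> w" for v
  proof (cases "v \<in> V \<and> v \<noteq> u")
    case True
    then show ?thesis using dom[of v] that by auto
  next
    case False
    then have v: "v = u \<or> v = p \<or> v = q \<or> v = r" using that by auto
    have pr: "u \<notin> T \<Longrightarrow> p \<in> T \<or> r \<in> T" using X mem by auto
    have "(p, u) \<in> A'" "(r, u) \<in> A'" unfolding arcs_iff by auto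
    then have "v = u \<Longrightarrow> ?thesis" using pr that by blast
    moreover have "p \<in> T \<or> u \<in> T \<or> w \<in> T" "q \<in> T \<or> w \<in> T \<or> r \<in> T" "r \<in> T \<or> q \<in> T \<or> u \<in> T"
      using X mem by auto
    then have "v = p \<Longrightarrow> ?thesis" "v = q \<Longrightarrow> ?thesis" "v = r \<Longrightarrow> ?thesis"
      using that arcs_iff by metis+
    ultimately show ?thesis using v by blast
  qed
  ultimately show ?L unfolding near_maximal_def using sub by auto
qed

lemma near_maximal_glued_dominates_end:
  assumes "near_maximal V' A' w T" "w \<notin> T"
  shows "\<exists>s\<in>T. (s, w) \<in> A'"
proof -
  have "p \<in> T \<or> q \<in> T"
    using assms unfolding near_maximal_glued_iff by auto
  then show ?thesis using arcs_iff(2) by blast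
qed

lemma near_maximal_extensions:
  assumes "X \<subseteq> {p, w, q, r}"
  shows "card {T. T \<subseteq> V' \<and> near_maximal V A u (T \<inter> V) \<and> (u \<in> T \<longleftrightarrow> P) \<and> T - V = X} =
    card {S. near_maximal V A u S \<and> (u \<in> S \<longleftrightarrow> P)}"
proof -
  have "bij_betw (\<lambda>S. S \<union> X) {S. near_maximal V A u S \<and> (u \<in> S \<longleftrightarrow> P)}
    {T. T \<subseteq> V' \<and> near_maximal V A u (T \<inter> V) \<and> (u \<in> T \<longleftrightarrow> P) \<and> T - V = X}"
  proof (rule bij_betw_byWitness[where f' = "\<lambda>T. T \<inter> V"])
    have XV: "X \<inter> V = {}" using assms disj by auto
    then have *: "(S \<union> X) \<inter> V = S" "S \<union> X - V = X" if "near_maximal V A u S" for S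
      using that unfolding near_maximal_def by auto
    have uX: "u \<notin> X" using XV u by auto
    show "\<forall>S\<in>{S. near_maximal V A u S \<and> (u \<in> S \<longleftrightarrow> P)}. (S \<union> X) \<inter> V = S"
      using * by auto
    show "(\<lambda>S. S \<union> X) ` {S. near_maximal V A u S \<and> (u \<in> S \<longleftrightarrow> P)} \<subseteq>
      {T. T \<subseteq> V' \<and> near_maximal V A u (T \<inter> V) \<and> (u \<in> T \<longleftrightarrow> P) \<and> T - V = X}"
    proof (intro image_subsetI, elim CollectE conjE, intro CollectI conjI)
      fix S assume S: "near_maximal V A u S" and P: "u \<in> S \<longleftrightarrow> P"
      have "S \<subseteq> V" using S unfolding near_maximal_def by blast
      then show "S \<union> X \<subseteq> V'" using assms by blast
      show "near_maximal V A u ((S \<union> X) \<inter> V)" "S \<union> X - V = X" using *[OF S] S by simp_all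
      show "u \<in> S \<union> X \<longleftrightarrow> P" using P uX by simp
    qed
    show "\<forall>T\<in>{T. T \<subseteq> V' \<and> near_maximal V A u (T \<inter> V) \<and> (u \<in> T \<longleftrightarrow> P) \<and> T - V = X}. T \<inter> V \<union> X = T"
      by blast
    show "(\<lambda>T. T \<inter> V) ` {T. T \<subseteq> V' \<and> near_maximal V A u (T \<inter> V) \<and> (u \<in> T \<longleftrightarrow> P) \<and> T - V = X} \<subseteq>
      {S. near_maximal V A u S \<and> (u \<in> S \<longleftrightarrow> P)}"
      using u by (intro image_subsetI) simp
  qed
  then show ?thesis by (rule bij_betw_same_card[symmetric])
qed

lemma card_near_maximal_glued:
  shows "card {T. near_maximal V' A' w T \<and> w \<in> T} =
      card {S. near_maximal V A u S \<and> u \<in> S} + card {S. near_maximal V A u S \<and> u \<notin> S}"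
    and "card {T. near_maximal V' A' w T \<and> w \<notin> T} =
      card {S. near_maximal V A u S \<and> u \<in> S} + 2 * card {S. near_maximal V A u S \<and> u \<notin> S}"
proof -
  define F where
    "F P X = {T. T \<subseteq> V' \<and> near_maximal V A u (T \<inter> V) \<and> (u \<in> T \<longleftrightarrow> P) \<and> T - V = X}" for P X
  have finF: "finite (F P X)" for P X
  proof (rule finite_subset)
    show "F P X \<subseteq> Pow V'" unfolding F_def by blast
    show "finite (Pow V')" using fin by simp
  qed
  have cardF: "card (F P X) = card {S. near_maximal V A u S \<and> (u \<in> S \<longleftrightarrow> P)}"
    if "X \<subseteq> {p, w, q, r}" for P X
    using near_maximal_extensions[OF that] unfolding F_def .
  have memF: "(u \<in> T) = P" "T - V = X" if "T \<in> F P X" for T P X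
    using that unfolding F_def by simp_all
  have disjF: "F P X \<inter> F Q Y = {}" if "P \<noteq> Q \<or> X \<noteq> Y" for P Q X Y
  proof (rule ccontr)
    assume "F P X \<inter> F Q Y \<noteq> {}"
    then obtain T where "T \<in> F P X" "T \<in> F Q Y" by blast
    with that memF[of T P X] memF[of T Q Y] show False by simp
  qed
  have ne: "{p, r} \<noteq> {p, q}" using dist by (auto simp: doubleton_eq_iff)
  have w_mem: "w \<in> T \<longleftrightarrow> w \<in> X" if "T \<in> F P X" for T P X
    using memF(2)[OF that] outside(2) by blast
  have w_in: "w \<in> T" if "T \<in> F True {w} \<or> T \<in> F False {w, r}" for T
    using that w_mem by blast
  have w_out: "w \<notin> T" if "T \<in> F True {q} \<or> T \<in> F False {p, r} \<or> T \<in> F False {p, q}" for T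
    using that w_mem[of T] dist by (elim disjE) (simp_all add: eq_commute[of w p])
  have glued: "near_maximal V' A' w T \<longleftrightarrow> T \<in> F True {w} \<or> T \<in> F True {q} \<or>
      T \<in> F False {w, r} \<or> T \<in> F False {p, r} \<or> T \<in> F False {p, q}" for T
    unfolding near_maximal_glued_iff F_def mem_Collect_eq by argo
  have "{T. near_maximal V' A' w T \<and> w \<in> T} = F True {w} \<union> F False {w, r}"
    unfolding glued using w_in w_out by blast
  then show "card {T. near_maximal V' A' w T \<and> w \<in> T} =
      card {S. near_maximal V A u S \<and> u \<in> S} + card {S. near_maximal V A u S \<and> u \<notin> S}"
    by (simp add: card_Un_disjoint finF disjF cardF)
  have "{T. near_maximal V' A' w T \<and> w \<notin> T} = F True {q} \<union> (F False {p, r} \<union> F False {p, q})"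
    unfolding glued using w_in w_out by blast
  then show "card {T. near_maximal V' A' w T \<and> w \<notin> T} =
      card {S. near_maximal V A u S \<and> u \<in> S} + 2 * card {S. near_maximal V A u S \<and> u \<notin> S}"
    by (simp add: card_Un_disjoint finF disjF cardF ne Int_Un_distrib)
qed

end

definition fib_counts :: "nat \<Rightarrow> 'a set \<Rightarrow> ('a \<times> 'a) set \<Rightarrow> 'a \<Rightarrow> bool" where
  "fib_counts k V A x \<longleftrightarrow>
    card {S. near_maximal V A x S \<and> x \<in> S} = fib (2 * k + 1) \<and>
    card {S. near_maximal V A x S \<and> x \<notin> S} = fib (2 * k + 2)"

lemma fib_counts_singleton: "fib_counts 0 {x} {} x"
proof -
  have "{S. near_maximal {x} {} x S \<and> x \<in> S} = {{x}}"
    "{S. near_maximal {x} {} x S \<and> x \<notin> S} = {{}}"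
    unfolding near_maximal_def by auto
  then show ?thesis unfolding fib_counts_def by simp
qed

lemma fib_counts_glue:
  assumes "fib_counts k V A u" "finite V" "A \<subseteq> V \<times> V" "is_cycle_graph 5 C"
    "V \<inter> pverts C = {u}" "w \<in> pverts C" "u \<noteq> w" "(u, w) \<notin> parcs C"
  shows "fib_counts (Suc k) (V \<union> pverts C) (A \<union> parcs C) w"
    and "near_maximal (V \<union> pverts C) (A \<union> parcs C) w T \<Longrightarrow> w \<notin> T \<Longrightarrow>
      \<exists>s\<in>T. (s, w) \<in> A \<union> parcs C"
proof -
  have u: "u \<in> pverts C" using assms(5) by auto
  obtain p q r where C: "distinct [u, p, w, q, r]" "pverts C = {u, p, w, q, r}"
    "parcs C = pentagon_arcs u p w q r"
    using pentagon_from_nonadjacent[OF assms(4) u assms(6-8)] by metis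
  interpret pentagon_glued V A u p w q r
    by unfold_locales (use assms C in auto)
  show "fib_counts (Suc k) (V \<union> pverts C) (A \<union> parcs C) w"
    using assms(1) card_near_maximal_glued unfolding fib_counts_def C(2,3)
    by (simp add: numeral_eq_Suc)
  show "near_maximal (V \<union> pverts C) (A \<union> parcs C) w T \<Longrightarrow> w \<notin> T \<Longrightarrow>
      \<exists>s\<in>T. (s, w) \<in> A \<union> parcs C"
    unfolding C(2,3) by (rule near_maximal_glued_dominates_end)
qed

theorem num_maximal_independent_sets_meta_pentagonal_cactus:
  assumes "meta_pentagonal_cactus n G" "n \<ge> 1"
  shows "num_maximal_independent_sets G = fib (2 * n + 3)"
proof -
  obtain B :: "nat \<Rightarrow> 'a pair_pre_digraph" where
    B: "\<forall>i\<in>{1..n}. is_cycle_graph 5 (B i)"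
      "pverts G = (\<Union>i\<in>{1..n}. pverts (B i))"
      "parcs G = (\<Union>i\<in>{1..n}. parcs (B i))"
      "\<forall>i. 1 \<le> i \<and> i + 1 \<le> n \<longrightarrow> card (pverts (B i) \<inter> pverts (B (i + 1))) = 1"
      "\<forall>i\<in>{1..n}. \<forall>j\<in>{1..n}. i + 1 < j \<longrightarrow> pverts (B i) \<inter> pverts (B j) = {}"
      "\<forall>i. 2 \<le> i \<and> i + 1 \<le> n \<longrightarrow>
        (\<forall>u \<in> pverts (B (i - 1)) \<inter> pverts (B i). \<forall>w \<in> pverts (B i) \<inter> pverts (B (i + 1)).
          graph_dist (B i) u w = 2)"
    using assms(1) unfolding meta_pentagonal_cactus_def by (elim exE conjE) (rule that)
  have cyc: "is_cycle_graph 5 (B i)" if "i \<in> {1..n}" for i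
    using B(1) that by blast
  have consec: "card (pverts (B i) \<inter> pverts (B (i + 1))) = 1" if "1 \<le> i" "i + 1 \<le> n" for i
    using B(4) that by blast
  have nonconsec: "pverts (B i) \<inter> pverts (B j) = {}"
    if "i \<in> {1..n}" "j \<in> {1..n}" "i + 1 < j" for i j
    using B(5) that by blast
  have d2: "graph_dist (B i) u w = 2"
    if "2 \<le> i" "i + 1 \<le> n" "u \<in> pverts (B (i - 1)) \<inter> pverts (B i)"
      "w \<in> pverts (B i) \<inter> pverts (B (i + 1))" for i u w
    using B(6) that by blast
  have pg: "pair_graph (B i)" if "i \<in> {1..n}" for i
    using cyc[OF that] by (intro is_cycle_graph_imp_pair_graph[of 5]) auto
  define V where "V k = (\<Union>i\<in>{1..k}. pverts (B i))" for k
  define A where "A k = (\<Union>i\<in>{1..k}. parcs (B i))" for k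
  have VS: "V (Suc k) = V k \<union> pverts (B (Suc k))" and AS: "A (Suc k) = A k \<union> parcs (B (Suc k))"
    for k unfolding V_def A_def by (auto simp: atLeastAtMostSuc_conv)
  have finV: "finite (V k)" if "k \<le> n" for k
    using that pg unfolding V_def
    by (auto simp: pair_graph_def pair_digraph_def pair_fin_digraph_def pair_fin_digraph_axioms_def)
  have AV: "A k \<subseteq> V k \<times> V k" if "k \<le> n" for k
  proof -
    have "parcs (B i) \<subseteq> pverts (B i) \<times> pverts (B i)" if "i \<in> {1..n}" for i
    proof -
      interpret pair_graph "B i" using pg[OF that] .
      show ?thesis using in_arcsD1 in_arcsD2 by auto
    qed
    then show ?thesis using that unfolding A_def V_def by fastforce
  qed
  \<comment> \<open>For \<open>k = 1\<close> the block has no entry vertex, and any vertex at distance two from \<open>x\<close> serves.\<close>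
  have main: "fib_counts k (V k) (A k) x \<and>
      (\<forall>T. near_maximal (V k) (A k) x T \<longrightarrow> x \<notin> T \<longrightarrow> (\<exists>s\<in>T. (s, x) \<in> A k))"
    if "1 \<le> k" "k \<le> n" "x \<in> pverts (B k)"
      "\<And>v. 2 \<le> k \<Longrightarrow> v \<in> pverts (B (k - 1)) \<inter> pverts (B k) \<Longrightarrow> v \<noteq> x \<and> (v, x) \<notin> parcs (B k)"
    for k x
    using that
  proof (induction k arbitrary: x rule: nat_induct_at_least)
    case base
    have c: "is_cycle_graph 5 (B 1)" using cyc assms(2) by simp
    obtain u where u: "u \<in> pverts (B 1)" "x \<noteq> u" "(u, x) \<notin> parcs (B 1)"
      using pentagon_nonadjacent_exists[OF c base(2)] by metis
    have eq: "V 1 = {u} \<union> pverts (B 1)" "A 1 = {} \<union> parcs (B 1)"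
      using u(1) unfolding V_def A_def by auto
    show ?case
      using fib_counts_glue[OF fib_counts_singleton _ _ c, of u x] u base(2)
      unfolding eq by auto
  next
    case (Suc k)
    have kn: "1 \<le> k" "k + 1 \<le> n" using Suc by auto
    obtain u where u: "pverts (B k) \<inter> pverts (B (Suc k)) = {u}"
      using consec[OF kn] by (auto simp: card_1_singleton_iff)
    have "pverts (B i) \<inter> pverts (B (Suc k)) = {}" if "i \<in> {1..k}" "i \<noteq> k" for i
      using nonconsec[of i "Suc k"] that kn by auto
    then have int: "V k \<inter> pverts (B (Suc k)) = {u}"
      using u kn unfolding V_def by fastforce
    have "fib_counts k (V k) (A k) u"
    proof (rule Suc.IH[THEN conjunct1])
      show "v \<noteq> u \<and> (v, u) \<notin> parcs (B k)"
        if "2 \<le> k" "v \<in> pverts (B (k - 1)) \<inter> pverts (B k)" for v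
        using graph_dist_eq_2D[OF pg _ d2[of k v u]] that u kn by auto
    qed (use u kn in auto)
    moreover have "u \<noteq> x" "(u, x) \<notin> parcs (B (Suc k))"
      using Suc.prems(3)[of u] u kn by auto
    ultimately show ?case
      using fib_counts_glue[OF _ finV AV cyc int, of k x] Suc.prems kn
      unfolding VS AS by auto
  qed
  have "\<exists>x\<in>pverts (B n). \<forall>v. 2 \<le> n \<longrightarrow> v \<in> pverts (B (n - 1)) \<inter> pverts (B n) \<longrightarrow>
      v \<noteq> x \<and> (v, x) \<notin> parcs (B n)"
  proof -
    have c: "is_cycle_graph 5 (B n)" using cyc assms(2) by simp
    obtain u where u: "u \<in> pverts (B n)" "2 \<le> n \<Longrightarrow> pverts (B (n - 1)) \<inter> pverts (B n) = {u}"
    proof (cases "2 \<le> n")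
      case True
      then have "card (pverts (B (n - 1)) \<inter> pverts (B n)) = 1" using consec[of "n - 1"] by auto
      then obtain u where "pverts (B (n - 1)) \<inter> pverts (B n) = {u}"
        by (auto simp: card_1_singleton_iff)
      then show thesis using that by blast
    next
      case False
      then show thesis using that pentagon_cases[OF c] by (metis insertI1)
    qed
    show ?thesis
      using pentagon_nonadjacent_exists[OF c u(1)] u(2) by (metis singletonD)
  qed
  then obtain x where x: "fib_counts n (V n) (A n) x"
      "\<And>T. near_maximal (V n) (A n) x T \<Longrightarrow> x \<notin> T \<Longrightarrow> \<exists>s\<in>T. (s, x) \<in> A n"
    using main[OF assms(2)] by blast
  have G: "pverts G = V n" "parcs G = A n" using B(2,3) V_def A_def by auto
  have mis: "maximal_independent_set G S \<longleftrightarrow> near_maximal (V n) (A n) x S" for S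
    using x(2)[of S]
    unfolding maximal_independent_set_iff[OF meta_pentagonal_cactus_imp_pair_graph[OF assms(1)]] G
      near_maximal_def by blast
  have fin: "finite {S. near_maximal (V n) (A n) x S \<and> Q S}" for Q
    by (rule finite_subset[of _ "Pow (V n)"]) (use finV in \<open>auto simp: near_maximal_def\<close>)
  have "{S. maximal_independent_set G S} =
      {S. near_maximal (V n) (A n) x S \<and> x \<in> S} \<union> {S. near_maximal (V n) (A n) x S \<and> x \<notin> S}"
    unfolding mis by auto
  then have "num_maximal_independent_sets G = fib (2 * n + 1) + fib (2 * n + 2)"
    unfolding num_maximal_independent_sets_def
    using x(1) fin by (subst (asm) fib_counts_def, simp, subst card_Un_disjoint) auto
  then show ?thesis by (simp add: numeral_eq_Suc)
qed

theorem theorem2p13: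
  fixes M :: "nat \<Rightarrow> 'a pair_pre_digraph" and m :: "nat \<Rightarrow> nat"
  assumes "\<And>n. n \<ge> 1 \<Longrightarrow> meta_pentagonal_cactus n (M n)"
    and "\<And>n. n \<ge> 1 \<Longrightarrow> m n = num_maximal_independent_sets (M n)"
  shows "m 1 = 5 \<and> m 2 = 13 \<and>
    (\<forall>n\<ge>3. int (m n) = 3 * int (m (n - 1)) - int (m (n - 2)))"
proof -
  have m: "m n = fib (2 * n + 3)" if "n \<ge> 1" for n
    using assms num_maximal_independent_sets_meta_pentagonal_cactus that by metis
  have "int (m n) = 3 * int (m (n - 1)) - int (m (n - 2))" if "n \<ge> 3" for n
  proof -
    obtain k where k: "n = k + 3" using \<open>n \<ge> 3\<close> by (metis le_add_diff_inverse2)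
    show ?thesis using m[of n] m[of "n - 1"] m[of "n - 2"] unfolding k
      by (simp add: numeral_eq_Suc)
  qed
  moreover have "m 1 = 5" "m 2 = 13"
    using m[of 1] m[of 2] by (simp_all add: numeral_eq_Suc)
  ultimately show ?thesis by blast
qed

end
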